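(* Let $1<p<\infty$. Let $\phi(x)=\inf_{k\in\mathbb{Z}}|x-k|$ for $x\in\mathbb{R}$. For $n\in\mathbb{N}=\{1,2,\dots\}$, let $g_n(x)=\phi(2^nx-1)\,\chi_{[0,1]}(2^nx-1)$ for $x\in[0,1]$, extended to a 1-periodic function on $\mathbb{R}$, where $\chi_{[0,1]}$ is the indicator function of $[0,1]$. Define $$f(x,y)=\sum_{n=1}^\infty2^{-n/p}g_n(x)\phi(2^ny),\qquad (x,y)\in\mathbb{R}^2.$$ Then $f\in H_p^{(2)}$ and $f\notin V_p[V_p]$.
   Context: For a 1-periodic function $h$ on $\mathbb{R}$, $v_p(h)=\sup_\Pi\big(\sum_{k=0}^{n-1}|h(x_{k+1})-h(x_k)|^p\big)^{1/p}$, the supremum over all partitions $\Pi=\{x_0<x_1<\dots<x_n=x_0+1\}$; $h\in V_p$ means $v_p(h)<\infty$. For a function $f(x,y)$ on $\mathbb{R}^2$, 1-periodic in both variables, $$v_p^{(2)}(f)=\sup_{\mathcal N}\Big(\sum_{i=0}^{m-1}\sum_{j=0}^{n-1}|f(x_{i+1},y_{j+1})-f(x_{i+1},y_j)-f(x_i,y_{j+1})+f(x_i,y_j)|^p\Big)^{1/p},$$ the supremum over all nets $\mathcal N=\{(x_i,y_j):0\le i\le m,\,0\le j\le n\}$ with $x_0<x_1<\dots<x_m=x_0+1$ and $y_0<y_1<\dots<y_n=y_0+1$. The space $H_p^{(2)}$ consists of all functions $f$, 1-periodic in both variables, such that $v_p^{(2)}(f)<\infty$ and, for every $x\in\mathbb{R}$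 and every $y\in\mathbb{R}$, the sections $f(x,\cdot)$ and $f(\cdot,y)$ belong to $V_p$. Put $\varphi_p[f](x)=v_p(f(x,\cdot))$ and $\psi_p[f](y)=v_p(f(\cdot,y))$. The class $V_p[V_p]$ consists of all functions $f$, 1-periodic in both variables, for which (with $\varphi_p[f]$ and $\psi_p[f]$ finite everywhere) $v_p(\varphi_p[f])+v_p(\psi_p[f])<\infty$. *)

theory Defs
  imports "HOL-Analysis.Analysis"
begin

definition periodic1 :: "(real \<Rightarrow> real) \<Rightarrow> bool" where
  "periodic1 h \<longleftrightarrow> (\<forall>x. h (x + 1) = h x)"

definition periodic2 :: "(real \<Rightarrow> real \<Rightarrow> real) \<Rightarrow> bool" where
  "periodic2 f \<longleftrightarrow> (\<forall>x y. f (x + 1) y = f x y \<and> f x (y + 1) = f x y)"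

text \<open>
  A partition is a sequence of which only the entries with index at most \<open>n\<close> matter.
  The last condition forces \<open>n \<ge> 1\<close>.
\<close>
definition period_partition :: "nat \<Rightarrow> (nat \<Rightarrow> real) \<Rightarrow> bool" where
  "period_partition n x \<longleftrightarrow> strict_mono_on {0..n} x \<and> x n = x 0 + 1"

text \<open>The variations take values in \<open>[0, \<infinity>]\<close>, so the suprema always make sense.\<close>

definition pvar :: "real \<Rightarrow> (real \<Rightarrow> real) \<Rightarrow> ennreal" where
  "pvar p h = (SUP (n, x) \<in> {(n, x). period_partition n x}.
     ennreal ((\<Sum>k<n. \<bar>h (x (Suc k)) - h (x k)\<bar> powr p) powr (1 / p)))"

definition pvar2 :: "real \<Rightarrow> (real \<Rightarrow> real \<Rightarrow> real) \<Rightarrow> ennreal" where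
  "pvar2 p f = (SUP (m, x, n, y) \<in> {(m, x, n, y). period_partition m x \<and> period_partition n y}.
     ennreal ((\<Sum>i<m. \<Sum>j<n.
       \<bar>f (x (Suc i)) (y (Suc j)) - f (x (Suc i)) (y j) - f (x i) (y (Suc j)) + f (x i) (y j)\<bar> powr p)
       powr (1 / p)))"

definition V_space :: "real \<Rightarrow> (real \<Rightarrow> real) set" where
  "V_space p = {h. periodic1 h \<and> pvar p h < \<infinity>}"

definition H2_space :: "real \<Rightarrow> (real \<Rightarrow> real \<Rightarrow> real) set" where
  "H2_space p = {f. periodic2 f \<and> pvar2 p f < \<infinity> \<and>
     (\<forall>x. (\<lambda>y. f x y) \<in> V_space p) \<and> (\<forall>y. (\<lambda>x. f x y) \<in> V_space p)}"

text \<open>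
  As real functions, the next two are meaningful only when the sections have finite variation
  (\<^const>\<open>enn2real\<close> sends \<open>\<infinity>\<close> to \<open>0\<close>); \<open>VV_space\<close> below requires this explicitly.
\<close>

definition phi_var :: "real \<Rightarrow> (real \<Rightarrow> real \<Rightarrow> real) \<Rightarrow> real \<Rightarrow> real" where
  "phi_var p f x = enn2real (pvar p (\<lambda>y. f x y))"

definition psi_var :: "real \<Rightarrow> (real \<Rightarrow> real \<Rightarrow> real) \<Rightarrow> real \<Rightarrow> real" where
  "psi_var p f y = enn2real (pvar p (\<lambda>x. f x y))"

definition VV_space :: "real \<Rightarrow> (real \<Rightarrow> real \<Rightarrow> real) set" where
  "VV_space p = {f. periodic2 f \<and>
     (\<forall>x. pvar p (\<lambda>y. f x y) < \<infinity>) \<and> (\<forall>y. pvar p (\<lambda>x. f x y) < \<infinity>) \<and>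
     pvar p (phi_var p f) + pvar p (psi_var p f) < \<infinity>}"

definition dist_int :: "real \<Rightarrow> real" where
  "dist_int x = (INF k\<in>\<int>. \<bar>x - k\<bar>)"

text \<open>
  The 1-periodic extension is obtained by evaluating at \<open>frac x\<close>. This is consistent with the
  formula at the endpoint \<open>x = 1\<close>: for \<open>n \<ge> 1\<close> it gives \<open>0\<close> at both \<open>0\<close> and \<open>1\<close>.
\<close>
definition bump :: "nat \<Rightarrow> real \<Rightarrow> real" where
  "bump n x = dist_int (2 ^ n * frac x - 1) * indicator {0..1} (2 ^ n * frac x - 1)"

text \<open>The sum over \<open>n \<ge> 1\<close> is reindexed by \<open>Suc\<close>.\<close>
definition bump_sum :: "real \<Rightarrow> real \<Rightarrow> real \<Rightarrow> real" where
  "bump_sum p x y = (\<Sum>n. 2 powr (- real (Suc n) / p) * bump (Suc n) x * dist_int (2 ^ Suc n * y))"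

end

theory Submission
  imports Defs
begin

text \<open>
  Write \<open>\<phi>\<close> for \<^const>\<open>dist_int\<close>, \<open>g\<^sub>n\<close> for \<^term>\<open>bump n\<close>, and
  \<open>f\<close> for \<^term>\<open>bump_sum p\<close>. In a period, \<open>g\<^sub>n\<close> lives on the dyadic interval
  from \<open>1/2^n\<close> to \<open>2/2^n\<close>, so at each \<open>x\<close> at most one term of the series is nonzero.

  Finite variation on nets. An increment of \<open>f\<close> over a rectangle is the sum over \<open>n\<close> of
  \<open>2^(-n/p) \<Delta>g\<^sub>n \<Delta>\<phi>(2^n \<cdot>)\<close>, where at most two terms are nonzero, one for each of the
  two abscissas. Its \<open>p\<close>-th power is therefore at most \<open>2^p\<close> times the sum of the \<open>p\<close>-th
  powers, and as \<open>\<bar>\<Delta>g\<^sub>n\<bar> \<le> 1\<close>, at most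
  \<open>2^p \<Sum>\<^sub>n 2^(-n) \<bar>\<Delta>g\<^sub>n\<bar> \<bar>\<Delta>\<phi>(2^n \<cdot>)\<bar>^p\<close> (lemma \<open>bump_combination_powr_le\<close>). The two
  variables can now be summed one after the other. In \<open>x\<close>, the total variation of
  \<open>g\<^sub>n\<close> over a period is at most \<open>1\<close> (\<open>bump_variation\<close>). What is left for a \<open>y\<close>-step of
  length \<open>h\<close> is \<open>\<Sum>\<^sub>n 2^(-n) min 1 (2^n h)^p\<close>. Because \<open>p > 1\<close>, this sum is dominated by the
  scales \<open>2^n\<close> near \<open>1/h\<close> and is at most a constant times \<open>h\<close> (\<open>dyadic_sum_le\<close>); adding up the
  steps \<open>h\<close> of a period gives a bound that does not depend on the net. The sections are treated
  in the same way, because \<open>f\<close> vanishes on both axes and increments of sections are thus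
  increments over rectangles with a side on an axis.

  Infinite mixed variation. At the points \<open>2^(-m)\<close> all bumps vanish, and so does the variation of
  the vertical section of \<open>f\<close>. Between two such points the section is a multiple of
  \<open>2^(-n/p) \<phi>(2^n \<cdot>)\<close>, where the weight \<open>2^(-n/p)\<close> is just compensated by the number of
  oscillations, about \<open>2^n\<close>. So the variation of the vertical section oscillates by a fixed
  amount infinitely often.
\<close>

section \<open>The distance to the nearest integer\<close>

lemma dist_int_eq_infdist: "dist_int x = infdist x \<int>"
  by (simp add: dist_int_def infdist_def dist_real_def) (metis Ints_0 empty_iff)

lemma dist_int_nonneg: "0 \<le> dist_int x"
  by (simp add: dist_int_eq_infdist infdist_nonneg)

lemma dist_int_lipschitz: "\<bar>dist_int x - dist_int y\<bar> \<le> \<bar>x - y\<bar>"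
  using infdist_triangle_abs[of x "\<int>" y] by (simp add: dist_int_eq_infdist dist_real_def)

text \<open>
  The sharp bound is \<open>1/2\<close>; the normalisation to \<open>1\<close> is convenient because powers
  with exponents at least \<open>1\<close> then only decrease the values.
\<close>
lemma dist_int_le_1: "dist_int x \<le> 1"
proof -
  have "dist_int x \<le> dist x (of_int \<lfloor>x\<rfloor>)"
    unfolding dist_int_eq_infdist by (rule infdist_le) simp
  also have "\<dots> \<le> 1"
    unfolding dist_real_def by linarith
  finally show ?thesis .
qed

lemma dist_int_add_of_int [simp]: "dist_int (x + of_int k) = dist_int x"
proof -
  have le: "dist_int (y + of_int j) \<le> dist_int y" for y :: real and j
    unfolding dist_int_def
  proof (rule cINF_greatest)
    fix i :: real assume i: "i \<in> \<int>"
    have "bdd_below ((\<lambda>k. \<bar>y + of_int j - k\<bar>) ` \<int>)"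
      by (rule bdd_belowI[of _ 0]) auto
    hence "(INF k\<in>\<int>. \<bar>y + of_int j - k\<bar>) \<le> \<bar>y + of_int j - (i + of_int j)\<bar>"
      by (rule cINF_lower) (simp add: i)
    thus "(INF k\<in>\<int>. \<bar>y + of_int j - k\<bar>) \<le> \<bar>y - i\<bar>" by simp
  qed (use Ints_0 in blast)
  show ?thesis
    using le[of x k] le[of "x + of_int k" "- k"] by simp
qed

lemma dist_int_on_unit:
  assumes "0 \<le> t" "t \<le> 1"
  shows "dist_int t = min t (1 - t)"
proof (rule antisym)
  have "dist_int t \<le> dist t 0" "dist_int t \<le> dist t 1"
    unfolding dist_int_eq_infdist by (rule infdist_le; simp)+
  thus "dist_int t \<le> min t (1 - t)"
    using assms by (simp add: dist_real_def)
  show "min t (1 - t) \<le> dist_int t"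
    unfolding dist_int_def
  proof (rule cINF_greatest)
    fix k :: real assume "k \<in> \<int>"
    then obtain j where j: "k = of_int j" by (auto elim: Ints_cases)
    have "j \<le> 0 \<or> 1 \<le> j" by linarith
    hence "k \<le> 0 \<or> 1 \<le> k" using j by auto
    thus "min t (1 - t) \<le> \<bar>t - k\<bar>" using assms by linarith
  qed (use Ints_0 in blast)
qed

lemma dist_int_of_int [simp]: "dist_int (of_int k) = 0"
  using dist_int_add_of_int[of 0 k] dist_int_on_unit[of 0] by simp

lemma dist_int_half: "dist_int (of_int k + 1 / 2) = 1 / 2"
  using dist_int_add_of_int[of "1/2" k] dist_int_on_unit[of "1/2"] by (simp add: add.commute)

section \<open>The bumps\<close>

text \<open>
  For \<open>n \<ge> 1\<close>, the lift of a circle map of degree one which climbs from one integer to the next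
  exactly where the bump lives and is constant elsewhere. The bump is \<^const>\<open>dist_int\<close> after this lift.
\<close>
definition ramp :: "nat \<Rightarrow> real \<Rightarrow> real" where
  "ramp n x = of_int \<lfloor>x\<rfloor> + max 0 (min 1 (2 ^ n * frac x - 1))"

lemma bump_eq_dist_int_ramp: "bump n x = dist_int (ramp n x)"
proof -
  define t where "t = 2 ^ n * frac x - 1"
  have "ramp n x = max 0 (min 1 t) + of_int \<lfloor>x\<rfloor>"
    by (simp add: ramp_def t_def)
  hence "dist_int (ramp n x) = dist_int (max 0 (min 1 t))" by simp
  also have "\<dots> = dist_int t * indicator {0..1} t"
    using dist_int_on_unit[of 0] dist_int_on_unit[of 1] by (auto simp: indicator_def max_def min_def)
  finally show ?thesis by (simp add: bump_def t_def)
qed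

lemma ramp_mono: "mono (ramp n)"
proof (rule monoI)
  fix x y :: real assume "x \<le> y"
  show "ramp n x \<le> ramp n y"
  proof (cases "\<lfloor>x\<rfloor> = \<lfloor>y\<rfloor>")
    case True
    hence "frac x \<le> frac y" using \<open>x \<le> y\<close> by (simp add: frac_def)
    hence "2 ^ n * frac x \<le> 2 ^ n * frac y" by simp
    thus ?thesis unfolding ramp_def True by linarith
  next
    case False
    hence "\<lfloor>x\<rfloor> + 1 \<le> \<lfloor>y\<rfloor>" using floor_mono[OF \<open>x \<le> y\<close>] by linarith
    hence "real_of_int \<lfloor>x\<rfloor> + 1 \<le> real_of_int \<lfloor>y\<rfloor>" by linarith
    thus ?thesis unfolding ramp_def by linarith
  qed
qed

lemma ramp_add_1: "ramp n (x + 1) = ramp n x + 1"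
  by (simp add: ramp_def frac_1_eq)

lemma bump_nonneg: "0 \<le> bump n x"
  and bump_le_1: "bump n x \<le> 1"
  by (simp_all add: bump_eq_dist_int_ramp dist_int_nonneg dist_int_le_1)

lemma bump_0 [simp]: "bump n 0 = 0"
  by (simp add: bump_def)

lemma period_partition_step:
  assumes "period_partition n x" "k < n"
  shows "x k < x (Suc k)"
  using assms unfolding period_partition_def by (auto intro: strict_mono_onD)

text \<open>
  \<^const>\<open>dist_int\<close> is 1-Lipschitz, so the increments of the bump are bounded by those of the
  monotone function \<^term>\<open>ramp n\<close>, which grows by exactly \<open>1\<close> in a period.
\<close>
lemma bump_variation:
  assumes "period_partition m x"
  shows "(\<Sum>i<m. \<bar>bump n (x (Suc i)) - bump n (x i)\<bar>) \<le> 1"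
proof -
  have "(\<Sum>i<m. \<bar>bump n (x (Suc i)) - bump n (x i)\<bar>) \<le> (\<Sum>i<m. ramp n (x (Suc i)) - ramp n (x i))"
  proof (rule sum_mono)
    fix i assume "i \<in> {..<m}"
    hence "ramp n (x i) \<le> ramp n (x (Suc i))"
      using period_partition_step[OF assms, of i] by (intro monoD[OF ramp_mono]) auto
    thus "\<bar>bump n (x (Suc i)) - bump n (x i)\<bar> \<le> ramp n (x (Suc i)) - ramp n (x i)"
      using dist_int_lipschitz[of "ramp n (x (Suc i))" "ramp n (x i)"]
      by (simp add: bump_eq_dist_int_ramp)
  qed
  also have "\<dots> = ramp n (x m) - ramp n (x 0)"
    by (rule sum_lessThan_telescope)
  also have "\<dots> = 1"
    using assms ramp_add_1[of n "x 0"] by (simp add: period_partition_def)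
  finally show ?thesis .
qed

lemma bump_nonzeroD:
  assumes "bump n x \<noteq> 0"
  shows "1 < 2 ^ n * frac x" "2 ^ n * frac x < 2"
proof -
  define t where "t = 2 ^ n * frac x - 1"
  have "dist_int t * indicator {0..1} t \<noteq> 0"
    using assms by (simp add: bump_def t_def)
  hence "0 < t \<and> t < 1"
    using dist_int_on_unit[of 0] dist_int_on_unit[of 1]
    by (cases "t = 0 \<or> t = 1") (auto simp: indicator_def split: if_splits)
  thus "1 < 2 ^ n * frac x" "2 ^ n * frac x < 2" by (auto simp: t_def)
qed

lemma bump_disjoint:
  assumes "bump n x \<noteq> 0" "bump m x \<noteq> 0"
  shows "n = m"
proof (rule ccontr)
  have no: False if "i < j" "bump i x \<noteq> 0" "bump j x \<noteq> 0" for i j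
  proof -
    have "(2::real) ^ Suc i \<le> 2 ^ j" using \<open>i < j\<close> by (intro power_increasing) auto
    hence "2 ^ Suc i * frac x \<le> 2 ^ j * frac x"
      by (intro mult_right_mono) simp_all
    with bump_nonzeroD[OF that(2)] bump_nonzeroD[OF that(3)] show False by simp
  qed
  assume "n \<noteq> m"
  thus False using no[of n m] no[of m n] assms by linarith
qed

text \<open>
  This makes the series for \<^const>\<open>bump_sum\<close> a finite sum, with a common number of terms for
  any finite set of abscissas.
\<close>
lemma eventually_bump_eq_0: "\<forall>\<^sub>F K in sequentially. \<forall>n\<ge>K. bump n x = 0"
proof (cases "\<exists>m. bump m x \<noteq> 0")
  case True
  then obtain m where m: "bump m x \<noteq> 0" by blast
  have "\<forall>\<^sub>F K in sequentially. m < K" by (rule eventually_gt_at_top)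
  thus ?thesis by eventually_elim (use bump_disjoint[OF m] in force)
qed simp

section \<open>Summing over the scales\<close>

lemma abs_sum_powr_le:
  fixes a :: "'a \<Rightarrow> real"
  assumes "finite S" "0 < p"
  shows "\<bar>\<Sum>n\<in>S. a n\<bar> powr p \<le> real (card S) powr p * (\<Sum>n\<in>S. \<bar>a n\<bar> powr p)"
proof -
  define M where "M = (\<Sum>n\<in>S. \<bar>a n\<bar> powr p)"
  have M0: "0 \<le> M" unfolding M_def by (rule sum_nonneg) simp
  have "\<bar>\<Sum>n\<in>S. a n\<bar> \<le> (\<Sum>n\<in>S. M powr (1 / p))"
  proof (rule order_trans[OF sum_abs sum_mono])
    fix n assume "n \<in> S"
    hence "\<bar>a n\<bar> powr p \<le> M"
      unfolding M_def by (intro member_le_sum) (use assms in auto)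
    hence "(\<bar>a n\<bar> powr p) powr (1 / p) \<le> M powr (1 / p)"
      using assms by (intro powr_mono2) auto
    thus "\<bar>a n\<bar> \<le> M powr (1 / p)" using assms by (simp add: powr_powr)
  qed
  also have "\<dots> = real (card S) * M powr (1 / p)" by simp
  finally have "\<bar>\<Sum>n\<in>S. a n\<bar> powr p \<le> (real (card S) * M powr (1 / p)) powr p"
    using assms by (intro powr_mono2) auto
  also have "\<dots> = real (card S) powr p * M"
    using assms M0 by (simp add: powr_mult powr_powr)
  finally show ?thesis unfolding M_def .
qed

text \<open>
  Each of the two points meets at most one bump, so the sum has at most two nonzero terms, whatever
  the coefficients \<open>c\<close>. Lowering the exponent of the bump increment from \<open>p\<close> to \<open>1\<close>
  prepares for summation by total variation.
\<close>
lemma bump_combination_powr_le: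
  assumes "1 \<le> p"
  shows "\<bar>\<Sum>n<K. 2 powr (- real (Suc n) / p) * (bump (Suc n) x' - bump (Suc n) x) * c n\<bar> powr p
    \<le> 2 powr p * (\<Sum>n<K. (1 / 2) ^ Suc n * \<bar>bump (Suc n) x' - bump (Suc n) x\<bar> * \<bar>c n\<bar> powr p)"
proof -
  define d where "d n = bump (Suc n) x' - bump (Suc n) x" for n
  define a where "a n = 2 powr (- real (Suc n) / p) * d n * c n" for n
  define S where "S = {n. n < K \<and> d n \<noteq> 0}"
  have fin: "finite S" and sub: "S \<subseteq> {..<K}" unfolding S_def by auto
  have card_le: "card S \<le> 2"
  proof -
    have one: "card {n. n < K \<and> bump (Suc n) z \<noteq> 0} \<le> 1" for z
      by (subst card_le_Suc0_iff_eq[unfolded One_nat_def[symmetric]]) (auto dest: bump_disjoint)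
    have "S \<subseteq> {n. n < K \<and> bump (Suc n) x' \<noteq> 0} \<union> {n. n < K \<and> bump (Suc n) x \<noteq> 0}"
      by (auto simp: S_def d_def)
    hence "card S \<le> card ({n. n < K \<and> bump (Suc n) x' \<noteq> 0} \<union> {n. n < K \<and> bump (Suc n) x \<noteq> 0})"
      by (intro card_mono) auto
    also have "\<dots> \<le> 1 + 1"
      by (rule order_trans[OF card_Un_le add_mono[OF one one]])
    finally show ?thesis by simp
  qed
  have term_le: "\<bar>a n\<bar> powr p \<le> (1 / 2) ^ Suc n * \<bar>d n\<bar> * \<bar>c n\<bar> powr p" for n
  proof -
    have d1: "\<bar>d n\<bar> \<le> 1"
      using bump_nonneg[of "Suc n" x] bump_nonneg[of "Suc n" x']
        bump_le_1[of "Suc n" x] bump_le_1[of "Suc n" x'] unfolding d_def by linarith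
    have "\<bar>d n\<bar> powr p \<le> \<bar>d n\<bar> powr 1"
      using powr_mono'[of 1 p "\<bar>d n\<bar>"] d1 assms by simp
    hence dp: "\<bar>d n\<bar> powr p \<le> \<bar>d n\<bar>" by simp
    have "(2 powr (- real (Suc n) / p)) powr p = 2 powr (- real (Suc n))"
      using assms by (simp add: powr_powr)
    also have "\<dots> = (1 / 2) ^ Suc n"
      by (simp only: powr_minus powr_realpow[OF zero_less_numeral] power_one_over inverse_eq_divide)
    finally have "\<bar>a n\<bar> powr p = (1 / 2) ^ Suc n * \<bar>d n\<bar> powr p * \<bar>c n\<bar> powr p"
      unfolding a_def abs_mult by (simp add: powr_mult)
    also have "\<dots> \<le> (1 / 2) ^ Suc n * \<bar>d n\<bar> * \<bar>c n\<bar> powr p"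
      using dp by (intro mult_right_mono mult_left_mono) auto
    finally show ?thesis .
  qed
  have "(\<Sum>n<K. a n) = (\<Sum>n\<in>S. a n)"
    using sub by (intro sum.mono_neutral_right) (auto simp: S_def a_def)
  hence "\<bar>\<Sum>n<K. a n\<bar> powr p \<le> real (card S) powr p * (\<Sum>n\<in>S. \<bar>a n\<bar> powr p)"
    using abs_sum_powr_le[OF fin, of p a] assms by simp
  also have "\<dots> \<le> 2 powr p * (\<Sum>n<K. \<bar>a n\<bar> powr p)"
    using card_le sub assms by (intro mult_mono powr_mono2 sum_mono2 sum_nonneg) auto
  also have "\<dots> \<le> 2 powr p * (\<Sum>n<K. (1 / 2) ^ Suc n * \<bar>d n\<bar> * \<bar>c n\<bar> powr p)"
    by (intro mult_left_mono sum_mono term_le) auto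
  finally show ?thesis by (simp only: a_def d_def)
qed

lemma bump_combination_variation:
  assumes "1 \<le> p" "period_partition m x"
  shows "(\<Sum>i<m. \<bar>\<Sum>n<K. 2 powr (- real (Suc n) / p) *
        (bump (Suc n) (x (Suc i)) - bump (Suc n) (x i)) * c n\<bar> powr p)
    \<le> 2 powr p * (\<Sum>n<K. (1 / 2) ^ Suc n * \<bar>c n\<bar> powr p)"
    (is "?L \<le> _")
proof -
  define d where "d i n = \<bar>bump (Suc n) (x (Suc i)) - bump (Suc n) (x i)\<bar>" for i n
  have "?L \<le> (\<Sum>i<m. 2 powr p * (\<Sum>n<K. (1 / 2) ^ Suc n * d i n * \<bar>c n\<bar> powr p))"
    unfolding d_def by (intro sum_mono bump_combination_powr_le assms)
  also have "\<dots> = 2 powr p * (\<Sum>n<K. \<Sum>i<m. (1 / 2) ^ Suc n * d i n * \<bar>c n\<bar> powr p)"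
    unfolding sum_distrib_left[symmetric] by (subst sum.swap) (rule refl)
  also have "\<dots> = 2 powr p * (\<Sum>n<K. (1 / 2) ^ Suc n * \<bar>c n\<bar> powr p * (\<Sum>i<m. d i n))"
    unfolding sum_distrib_left by (simp only: mult_ac)
  also have "\<dots> \<le> 2 powr p * (\<Sum>n<K. (1 / 2) ^ Suc n * \<bar>c n\<bar> powr p * 1)"
    unfolding d_def by (intro mult_left_mono sum_mono bump_variation assms) auto
  finally show ?thesis by simp
qed

text \<open>
  The sum \<open>S\<^sub>K(h)\<close> obeys the recursion \<open>S\<^sub>K\<^sub>+\<^sub>1(h) = min 1 h ^ p + S\<^sub>K(2 h) / 2\<close>. The proof finds
  a function \<open>psi\<close> with \<open>min 1 h ^ p + psi (2 h) / 2 \<le> psi h\<close>, which dominates all the \<open>S\<^sub>K\<close> by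
  induction. For \<open>h > 1\<close> the full geometric series suggests the value \<open>2\<close>. For \<open>h \<le> 1\<close>, the linear
  function \<open>C h\<close> reproduces itself under \<open>psi \<mapsto> psi (2 \<cdot>) / 2\<close>, and the correction \<open>- B h^p\<close>
  absorbs the inhomogeneous term; this needs \<open>2^(p-1) > 1\<close>.
\<close>
lemma dyadic_sum_le:
  fixes p :: real
  assumes "1 < p"
  obtains C where "0 \<le> C"
    and "\<And>h K. 0 < h \<Longrightarrow> (\<Sum>n<K. (1 / 2) ^ n * min 1 (2 ^ n * h) powr p) \<le> C * h"
proof -
  \<comment> \<open>\<open>B\<close> makes the recursion exact while \<open>2 h \<le> 1\<close>; \<open>C\<close> is large enough to bridge the gap to
    the value \<open>2\<close> for \<open>h\<close> between \<open>1/2\<close> and \<open>1\<close>.\<close>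
  define B where "B = 1 / (2 powr (p - 1) - 1)"
  define C where "C = 2 * (2 + B)"
  define psi where "psi h = (if h \<le> 1 then C * h - B * h powr p else 2)" for h
  have gt1: "1 < 2 powr (p - 1)" using assms powr_less_mono[of 0 "p - 1" 2] by simp
  have B0: "0 < B" using gt1 by (simp add: B_def)
  have B_eq: "B * 2 powr (p - 1) = 1 + B"
  proof -
    have "t / (t - 1) = 1 + 1 / (t - 1)" if "1 < t" for t :: real
      using that by (simp add: field_simps)
    from this[OF gt1] show ?thesis by (simp add: B_def)
  qed
  have step: "min 1 h powr p + psi (2 * h) / 2 \<le> psi h" if "0 < h" for h
  proof -
    consider "1 < h" | "h \<le> 1" "1 < 2 * h" | "2 * h \<le> 1" by linarith
    thus ?thesis
    proof cases
      case 1
      thus ?thesis by (simp add: psi_def)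
    next
      case 2
      have "h powr p \<le> 1" using 2 that assms by (simp add: powr_le1)
      hence "(1 + B) * h powr p \<le> (1 + B) * 1" using B0 by (intro mult_left_mono) auto
      moreover have "(2 + B) * 1 \<le> (2 + B) * (2 * h)" using 2 B0 by (intro mult_left_mono) auto
      ultimately show ?thesis using 2 by (simp add: psi_def C_def algebra_simps)
    next
      case 3
      have "(2 * h) powr p = 2 * 2 powr (p - 1) * h powr p"
        using that by (simp add: powr_mult powr_diff)
      hence "B * (2 * h) powr p = 2 * (B * 2 powr (p - 1)) * h powr p" by simp
      hence "B * (2 * h) powr p = 2 * (1 + B) * h powr p" by (simp only: B_eq)
      thus ?thesis using 3 that by (simp add: psi_def field_simps)
    qed
  qed
  have psi_nonneg: "0 \<le> psi h" if "0 < h" for h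
  proof (cases "h \<le> 1")
    case True
    have "h powr p \<le> h powr 1" using powr_mono'[of 1 p h] that True assms by simp
    hence "B * h powr p \<le> B * h" using B0 that by simp
    also have "\<dots> \<le> C * h" unfolding C_def using B0 that by (intro mult_right_mono) auto
    finally show ?thesis using True by (simp add: psi_def)
  qed (simp add: psi_def)
  have bound: "(\<Sum>n<K. (1 / 2) ^ n * min 1 (2 ^ n * h) powr p) \<le> psi h" if "0 < h" for h K
    using that
  proof (induction K arbitrary: h)
    case 0
    thus ?case using psi_nonneg by simp
  next
    case (Suc K)
    have "(\<Sum>n<Suc K. (1 / 2) ^ n * min 1 (2 ^ n * h) powr p)
      = min 1 h powr p + (\<Sum>n<K. (1 / 2) ^ n * min 1 (2 ^ n * (2 * h)) powr p) / 2"
      by (simp only: sum.lessThan_Suc_shift) (simp add: sum_divide_distrib mult_ac)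
    also have "\<dots> \<le> min 1 h powr p + psi (2 * h) / 2"
      using Suc.IH[of "2 * h"] Suc.prems by simp
    also have "\<dots> \<le> psi h" by (rule step) fact
    finally show ?case .
  qed
  show ?thesis
  proof
    show "0 \<le> C" using B0 by (simp add: C_def)
    fix h :: real and K assume h: "0 < h"
    have "psi h \<le> C * h"
    proof (cases "h \<le> 1")
      case False
      have "2 * 1 \<le> C * h" using False B0 by (intro mult_mono) (auto simp: C_def)
      thus ?thesis using False by (simp add: psi_def)
    qed (use B0 in \<open>simp add: psi_def\<close>)
    with bound[OF h, of K]
    show "(\<Sum>n<K. (1 / 2) ^ n * min 1 (2 ^ n * h) powr p) \<le> C * h" by linarith
  qed
qed

lemma dist_int_scales_le:
  fixes p :: real
  assumes "1 < p"
  obtains C where "0 \<le> C"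
    and "\<And>y y' K. y < y' \<Longrightarrow> (\<Sum>n<K. (1 / 2) ^ Suc n *
          \<bar>dist_int (2 ^ Suc n * y') - dist_int (2 ^ Suc n * y)\<bar> powr p) \<le> C * (y' - y)"
proof -
  obtain C where C: "0 \<le> C"
    "\<And>h K. 0 < h \<Longrightarrow> (\<Sum>n<K. (1 / 2) ^ n * min 1 (2 ^ n * h) powr p) \<le> C * h"
    using dyadic_sum_le[OF assms] by blast
  show ?thesis
  proof (rule that[OF C(1)])
    fix y y' :: real and K assume "y < y'"
    have "(\<Sum>n<K. (1 / 2) ^ Suc n * \<bar>dist_int (2 ^ Suc n * y') - dist_int (2 ^ Suc n * y)\<bar> powr p)
      \<le> (\<Sum>n<K. (1 / 2) ^ Suc n * min 1 (2 ^ n * (2 * (y' - y))) powr p)"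
    proof (intro sum_mono mult_left_mono powr_mono2)
      fix n
      have "\<bar>dist_int (2 ^ Suc n * y') - dist_int (2 ^ Suc n * y)\<bar> \<le> 1"
        using dist_int_nonneg[of "2 ^ Suc n * y"] dist_int_nonneg[of "2 ^ Suc n * y'"]
          dist_int_le_1[of "2 ^ Suc n * y"] dist_int_le_1[of "2 ^ Suc n * y'"] by linarith
      moreover have "\<bar>2 ^ Suc n * y' - 2 ^ Suc n * y\<bar> = 2 ^ n * (2 * (y' - y))"
        using \<open>y < y'\<close> by (simp add: algebra_simps)
      ultimately show "\<bar>dist_int (2 ^ Suc n * y') - dist_int (2 ^ Suc n * y)\<bar>
        \<le> min 1 (2 ^ n * (2 * (y' - y)))"
        using dist_int_lipschitz[of "2 ^ Suc n * y'" "2 ^ Suc n * y"] by linarith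
    qed (use assms in auto)
    also have "\<dots> = (\<Sum>n<K. (1 / 2) ^ n * min 1 (2 ^ n * (2 * (y' - y))) powr p) / 2"
      by (simp add: sum_divide_distrib)
    also have "\<dots> \<le> C * (2 * (y' - y)) / 2"
      using C(2)[of "2 * (y' - y)" K] \<open>y < y'\<close> by (intro divide_right_mono) auto
    finally show "(\<Sum>n<K. (1 / 2) ^ Suc n *
        \<bar>dist_int (2 ^ Suc n * y') - dist_int (2 ^ Suc n * y)\<bar> powr p) \<le> C * (y' - y)"
      by (simp only: times_divide_eq_right mult.left_commute[of C 2])
  qed
qed

section \<open>Finiteness of the variations\<close>

lemma bump_sum_eq_finite:
  assumes "\<forall>n\<ge>K. bump n x = 0"
  shows "bump_sum p x y
    = (\<Sum>n<K. 2 powr (- real (Suc n) / p) * bump (Suc n) x * dist_int (2 ^ Suc n * y))"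
  unfolding bump_sum_def using assms by (intro suminf_finite) auto

lemma periodic2_bump_sum: "periodic2 (bump_sum p)"
proof -
  have "bump n (x + 1) = bump n x" for n x
    by (simp add: bump_def frac_1_eq)
  moreover have "dist_int (2 ^ n * (y + 1)) = dist_int (2 ^ n * y)" for n y
    using dist_int_add_of_int[of "2 ^ n * y" "2 ^ n"] by (simp add: distrib_left)
  ultimately show ?thesis by (simp only: periodic2_def bump_sum_def simp_thms)
qed

lemma bump_sum_right_0: "bump_sum p x 0 = 0"
  using dist_int_of_int[of 0] by (simp add: bump_sum_def)

lemma bump_sum_left_0: "bump_sum p 0 y = 0"
  by (simp add: bump_sum_def)

lemma bump_sum_rectangle:
  assumes "\<forall>n\<ge>K. bump n x = 0" "\<forall>n\<ge>K. bump n x' = 0"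
  shows "bump_sum p x' y' - bump_sum p x' y - bump_sum p x y' + bump_sum p x y
    = (\<Sum>n<K. 2 powr (- real (Suc n) / p) * (bump (Suc n) x' - bump (Suc n) x) *
        (dist_int (2 ^ Suc n * y') - dist_int (2 ^ Suc n * y)))"
  unfolding bump_sum_eq_finite[OF assms(1)] bump_sum_eq_finite[OF assms(2)]
    sum_subtractf[symmetric] sum.distrib[symmetric]
  by (intro sum.cong) (simp_all add: algebra_simps)

lemma partition_bump_eq_0:
  fixes x :: "nat \<Rightarrow> real"
  obtains K where "\<And>i n. i \<le> m \<Longrightarrow> K \<le> n \<Longrightarrow> bump n (x i) = 0"
proof -
  have "\<forall>\<^sub>F K in sequentially. \<forall>i\<in>{..m}. \<forall>n\<ge>K. bump n (x i) = 0"
    by (intro eventually_ball_finite ballI eventually_bump_eq_0) simp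
  thus ?thesis using that by (auto simp: eventually_sequentially)
qed

text \<open>
  For a fixed \<open>y\<close>-step all scales are summed over the \<open>x\<close>-partition by
  \<open>bump_combination_variation\<close>; the bound is then linear in the length of the \<open>y\<close>-step, and
  these lengths add up to \<open>1\<close>.
\<close>
lemma bump_sum_net_le:
  assumes "1 < p"
  obtains C where "\<And>m x n y. period_partition m x \<Longrightarrow> period_partition n y \<Longrightarrow>
    (\<Sum>i<m. \<Sum>j<n. \<bar>bump_sum p (x (Suc i)) (y (Suc j)) - bump_sum p (x (Suc i)) (y j)
        - bump_sum p (x i) (y (Suc j)) + bump_sum p (x i) (y j)\<bar> powr p) \<le> C"
proof -
  obtain C where C: "0 \<le> C"
    "\<And>y y' K. y < y' \<Longrightarrow> (\<Sum>n<K. (1 / 2) ^ Suc n *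
          \<bar>dist_int (2 ^ Suc n * y') - dist_int (2 ^ Suc n * y)\<bar> powr p) \<le> C * (y' - y)"
    using dist_int_scales_le[OF assms] by blast
  show ?thesis
  proof (rule that)
    fix m x n y assume px: "period_partition m x" and py: "period_partition n y"
    obtain K where K: "\<And>i n. i \<le> m \<Longrightarrow> K \<le> n \<Longrightarrow> bump n (x i) = 0"
      using partition_bump_eq_0[of m x] by blast
    define D where "D i j = bump_sum p (x (Suc i)) (y (Suc j)) - bump_sum p (x (Suc i)) (y j)
        - bump_sum p (x i) (y (Suc j)) + bump_sum p (x i) (y j)" for i j
    have row: "(\<Sum>i<m. \<bar>D i j\<bar> powr p) \<le> 2 powr p * (C * (y (Suc j) - y j))" if "j < n" for j
    proof -
      define c where "c k = dist_int (2 ^ Suc k * y (Suc j)) - dist_int (2 ^ Suc k * y j)" for k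
      have "(\<Sum>i<m. \<bar>D i j\<bar> powr p) = (\<Sum>i<m. \<bar>\<Sum>k<K. 2 powr (- real (Suc k) / p) *
          (bump (Suc k) (x (Suc i)) - bump (Suc k) (x i)) * c k\<bar> powr p)"
      proof (rule sum.cong[OF refl])
        fix i assume "i \<in> {..<m}"
        hence "D i j = (\<Sum>k<K. 2 powr (- real (Suc k) / p) *
          (bump (Suc k) (x (Suc i)) - bump (Suc k) (x i)) * c k)"
          unfolding D_def c_def by (intro bump_sum_rectangle) (auto simp: K)
        thus "\<bar>D i j\<bar> powr p = \<bar>\<Sum>k<K. 2 powr (- real (Suc k) / p) *
          (bump (Suc k) (x (Suc i)) - bump (Suc k) (x i)) * c k\<bar> powr p" by simp
      qed
      also have "\<dots> \<le> 2 powr p * (\<Sum>k<K. (1 / 2) ^ Suc k * \<bar>c k\<bar> powr p)"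
        by (rule bump_combination_variation[OF _ px]) (use assms in simp)
      also have "\<dots> \<le> 2 powr p * (C * (y (Suc j) - y j))"
        unfolding c_def by (intro mult_left_mono C period_partition_step[OF py that]) simp
      finally show ?thesis .
    qed
    have "(\<Sum>i<m. \<Sum>j<n. \<bar>D i j\<bar> powr p) = (\<Sum>j<n. \<Sum>i<m. \<bar>D i j\<bar> powr p)"
      by (rule sum.swap)
    also have "\<dots> \<le> (\<Sum>j<n. 2 powr p * (C * (y (Suc j) - y j)))"
      by (intro sum_mono row) simp
    also have "\<dots> = 2 powr p * (C * (y n - y 0))"
      by (simp only: sum_distrib_left[symmetric] sum_lessThan_telescope)
    also have "\<dots> = 2 powr p * C"
      using py by (simp add: period_partition_def)
    finally show "(\<Sum>i<m. \<Sum>j<n. \<bar>bump_sum p (x (Suc i)) (y (Suc j)) - bump_sum p (x (Suc i)) (y j)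
        - bump_sum p (x i) (y (Suc j)) + bump_sum p (x i) (y j)\<bar> powr p) \<le> 2 powr p * C"
      unfolding D_def .
  qed
qed

lemma pvar_finiteI:
  assumes "0 < p"
    and "\<And>n x. period_partition n x \<Longrightarrow> (\<Sum>k<n. \<bar>h (x (Suc k)) - h (x k)\<bar> powr p) \<le> C"
  shows "pvar p h < \<infinity>"
proof -
  have "pvar p h \<le> ennreal (C powr (1 / p))"
    unfolding pvar_def using assms
    by (intro SUP_least) (auto intro!: ennreal_leI powr_mono2 sum_nonneg)
  thus ?thesis by (rule le_less_trans) simp
qed

lemma pvar2_finiteI:
  assumes "0 < p"
    and "\<And>m x n y. period_partition m x \<Longrightarrow> period_partition n y \<Longrightarrow>
      (\<Sum>i<m. \<Sum>j<n. \<bar>f (x (Suc i)) (y (Suc j)) - f (x (Suc i)) (y j)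
        - f (x i) (y (Suc j)) + f (x i) (y j)\<bar> powr p) \<le> C"
  shows "pvar2 p f < \<infinity>"
proof -
  have "pvar2 p f \<le> ennreal (C powr (1 / p))"
    unfolding pvar2_def using assms
    by (intro SUP_least) (auto intro!: ennreal_leI powr_mono2 sum_nonneg)
  thus ?thesis by (rule le_less_trans) simp
qed

text \<open>
  The increments are those over rectangles with lower side on the axis \<open>y = 0\<close>, where
  \<^const>\<open>bump_sum\<close> vanishes.
\<close>
lemma pvar_bump_sum_horizontal:
  assumes "1 < p"
  shows "pvar p (\<lambda>x. bump_sum p x y) < \<infinity>"
proof (rule pvar_finiteI)
  show "0 < p" using assms by simp
  fix m x assume px: "period_partition m x"
  obtain K where K: "\<And>i n. i \<le> m \<Longrightarrow> K \<le> n \<Longrightarrow> bump n (x i) = 0"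
    using partition_bump_eq_0[of m x] by blast
  define c where "c k = dist_int (2 ^ Suc k * y)" for k
  have "(\<Sum>i<m. \<bar>bump_sum p (x (Suc i)) y - bump_sum p (x i) y\<bar> powr p)
    = (\<Sum>i<m. \<bar>\<Sum>k<K. 2 powr (- real (Suc k) / p) *
          (bump (Suc k) (x (Suc i)) - bump (Suc k) (x i)) * c k\<bar> powr p)"
  proof (rule sum.cong[OF refl])
    fix i assume "i \<in> {..<m}"
    hence "bump_sum p (x (Suc i)) y - bump_sum p (x i) y = (\<Sum>k<K. 2 powr (- real (Suc k) / p) *
      (bump (Suc k) (x (Suc i)) - bump (Suc k) (x i)) * c k)"
      using bump_sum_rectangle[of K "x i" "x (Suc i)" p y 0] dist_int_of_int[of 0]
      by (simp add: K bump_sum_right_0 c_def)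
    thus "\<bar>bump_sum p (x (Suc i)) y - bump_sum p (x i) y\<bar> powr p
      = \<bar>\<Sum>k<K. 2 powr (- real (Suc k) / p) *
          (bump (Suc k) (x (Suc i)) - bump (Suc k) (x i)) * c k\<bar> powr p" by simp
  qed
  also have "\<dots> \<le> 2 powr p * (\<Sum>k<K. (1 / 2) ^ Suc k * \<bar>c k\<bar> powr p)"
    by (rule bump_combination_variation[OF _ px]) (use assms in simp)
  also have "\<dots> \<le> 2 powr p * (\<Sum>k<K. (1 / 2) ^ Suc k * 1)"
    using assms dist_int_nonneg dist_int_le_1
    by (intro mult_left_mono sum_mono powr_le1) (auto simp: c_def)
  also have "\<dots> \<le> 2 powr p * 1"
    by (intro mult_left_mono) (simp_all add: sum_gp_strict flip: sum_divide_distrib)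
  finally show "(\<Sum>i<m. \<bar>bump_sum p (x (Suc i)) y - bump_sum p (x i) y\<bar> powr p) \<le> 2 powr p"
    by simp
qed

text \<open>
  Here the left side of the rectangles is on the axis \<open>x = 0\<close>.
\<close>
lemma pvar_bump_sum_vertical:
  assumes "1 < p"
  shows "pvar p (bump_sum p x) < \<infinity>"
proof -
  obtain C where C: "0 \<le> C"
    "\<And>y y' K. y < y' \<Longrightarrow> (\<Sum>n<K. (1 / 2) ^ Suc n *
          \<bar>dist_int (2 ^ Suc n * y') - dist_int (2 ^ Suc n * y)\<bar> powr p) \<le> C * (y' - y)"
    using dist_int_scales_le[OF assms] by blast
  obtain K where K: "\<forall>n\<ge>K. bump n x = 0"
    using eventually_bump_eq_0[of x] by (auto simp: eventually_sequentially)
  show ?thesis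
  proof (rule pvar_finiteI)
    show "0 < p" using assms by simp
    fix m y assume py: "period_partition m y"
    have "(\<Sum>j<m. \<bar>bump_sum p x (y (Suc j)) - bump_sum p x (y j)\<bar> powr p)
      \<le> (\<Sum>j<m. 2 powr p * (C * (y (Suc j) - y j)))"
    proof (rule sum_mono)
      fix j assume "j \<in> {..<m}"
      hence less: "y j < y (Suc j)" using period_partition_step[OF py] by simp
      define c where "c k = dist_int (2 ^ Suc k * y (Suc j)) - dist_int (2 ^ Suc k * y j)" for k
      have "\<bar>bump_sum p x (y (Suc j)) - bump_sum p x (y j)\<bar> powr p
        = \<bar>\<Sum>k<K. 2 powr (- real (Suc k) / p) * (bump (Suc k) x - bump (Suc k) 0) * c k\<bar> powr p"
        unfolding c_def using bump_sum_rectangle[of K 0 x p "y (Suc j)" "y j"] K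
        by (simp add: bump_sum_left_0)
      also have "\<dots> \<le> 2 powr p *
          (\<Sum>k<K. (1 / 2) ^ Suc k * \<bar>bump (Suc k) x - bump (Suc k) 0\<bar> * \<bar>c k\<bar> powr p)"
        by (rule bump_combination_powr_le) (use assms in simp)
      also have "\<dots> \<le> 2 powr p * (\<Sum>k<K. (1 / 2) ^ Suc k * 1 * \<bar>c k\<bar> powr p)"
        using bump_nonneg bump_le_1
        by (intro mult_left_mono mult_right_mono sum_mono) auto
      also have "\<dots> \<le> 2 powr p * (C * (y (Suc j) - y j))"
        using C(2)[OF less, of K] unfolding c_def by (intro mult_left_mono) auto
      finally show "\<bar>bump_sum p x (y (Suc j)) - bump_sum p x (y j)\<bar> powr p
        \<le> 2 powr p * (C * (y (Suc j) - y j))" .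
    qed
    also have "\<dots> = 2 powr p * (C * (y m - y 0))"
      by (simp only: sum_distrib_left[symmetric] sum_lessThan_telescope)
    also have "\<dots> = 2 powr p * C"
      using py by (simp add: period_partition_def)
    finally show "(\<Sum>j<m. \<bar>bump_sum p x (y (Suc j)) - bump_sum p x (y j)\<bar> powr p)
      \<le> 2 powr p * C" .
  qed
qed

lemma bump_sum_in_H2_space:
  assumes "1 < p"
  shows "bump_sum p \<in> H2_space p"
proof -
  obtain C where "\<And>m x n y. period_partition m x \<Longrightarrow> period_partition n y \<Longrightarrow>
    (\<Sum>i<m. \<Sum>j<n. \<bar>bump_sum p (x (Suc i)) (y (Suc j)) - bump_sum p (x (Suc i)) (y j)
        - bump_sum p (x i) (y (Suc j)) + bump_sum p (x i) (y j)\<bar> powr p) \<le> C"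
    using bump_sum_net_le[OF assms] by blast
  hence "pvar2 p (bump_sum p) < \<infinity>"
    using assms by (intro pvar2_finiteI) auto
  thus ?thesis
    using periodic2_bump_sum pvar_bump_sum_horizontal[OF assms] pvar_bump_sum_vertical[OF assms]
    by (auto simp: H2_space_def V_space_def periodic1_def periodic2_def)
qed

section \<open>Oscillation of the variation of the sections\<close>

lemma pvar_ge:
  assumes "period_partition n x"
  shows "ennreal ((\<Sum>k<n. \<bar>h (x (Suc k)) - h (x k)\<bar> powr p) powr (1 / p)) \<le> pvar p h"
  unfolding pvar_def using assms by (intro SUP_upper2[of "(n, x)"]) auto

text \<open>
  The support of a bump in a period is an interval between successive powers of \<open>2\<close>, so no
  power of \<open>2\<close> is interior to it.
\<close>
lemma bump_at_power:
  "bump n (2 powr - real m) = 0"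
proof (rule ccontr)
  assume nz: "bump n (2 powr - real m) \<noteq> 0"
  show False
  proof (cases "m = 0")
    case True
    thus False using nz by (simp add: bump_def)
  next
    case False
    hence "2 powr - real m < 1" by (simp add: powr_less_one)
    hence "frac (2 powr - real m) = 2 powr - real m" by (simp add: frac_eq)
    hence eq: "2 ^ n * frac (2 powr - real m) = 2 powr (real n - real m)"
      by (simp add: powr_realpow powr_diff powr_minus field_simps)
    hence "2 powr 0 < 2 powr (real n - real m)" "2 powr (real n - real m) < 2 powr (1::real)"
      using bump_nonzeroD[OF nz] by simp_all
    hence "0 < real n - real m" "real n - real m < 1"
      by (simp_all only: powr_less_cancel_iff one_less_numeral_iff semiring_norm)
    hence "m < n" "n < m + 1" by linarith+
    thus False by simp
  qed
qed

text \<open>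
  The geometric midpoint of the support serves as the intermediate point, rather than the peak at
  \<open>3/2\<close> times the left end: zeros and intermediate points then form the single sequence
  \<open>2^(-i/2)\<close>, which makes the partition below a geometric progression.
\<close>
lemma bump_at_half_power:
  "bump (Suc m) (2 powr - (real m + 1 / 2)) = sqrt 2 - 1"
proof -
  have "2 powr - (real m + 1 / 2) < 1" by (rule powr_less_one) auto
  hence "frac (2 powr - (real m + 1 / 2)) = 2 powr - (real m + 1 / 2)" by (simp add: frac_eq)
  hence "2 ^ Suc m * frac (2 powr - (real m + 1 / 2)) = 2 powr (real (Suc m) + - (real m + 1 / 2))"
    by (simp only: powr_add powr_realpow[OF zero_less_numeral])
  also have "\<dots> = sqrt 2" by (simp add: powr_half_sqrt)
  finally have t: "2 ^ Suc m * frac (2 powr - (real m + 1 / 2)) = sqrt 2" .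
  have "sqrt 2 \<le> 3 / 2" by (rule real_le_lsqrt) (simp_all add: power2_eq_square)
  hence s: "1 \<le> sqrt 2" "sqrt 2 \<le> 3 / 2" by simp_all
  show ?thesis
    unfolding bump_def t using dist_int_on_unit[of "sqrt 2 - 1"] s
    by (simp add: indicator_def)
qed

lemma phi_var_at_power: "phi_var p (bump_sum p) (2 powr - real m) = 0"
proof -
  have "bump_sum p (2 powr - real m) = (\<lambda>_. 0)"
    by (simp add: fun_eq_iff bump_sum_def bump_at_power)
  hence "pvar p (bump_sum p (2 powr - real m)) \<le> 0"
    unfolding pvar_def by (intro SUP_least) auto
  thus ?thesis by (simp add: phi_var_def)
qed

text \<open>
  Sampling the section at all half periods of \<open>\<phi>(2^(m+1) \<cdot>)\<close> gives \<open>2^(m+2)\<close> jumps of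
  size \<open>c = 2^(-(m+1)/p) (sqrt 2 - 1)/2\<close>. The number of jumps compensates the weight, and the lower
  bound is the same for all \<open>m\<close>.
\<close>
lemma phi_var_at_half_power:
  assumes "1 < p"
  shows "(sqrt 2 - 1) / 2 \<le> phi_var p (bump_sum p) (2 powr - (real m + 1 / 2))"
proof -
  define x where "x = 2 powr - (real m + 1 / 2)"
  define c where "c = 2 powr (- real (Suc m) / p) * ((sqrt 2 - 1) / 2)"
  define N where "N = (2::nat) ^ Suc (Suc m)"
  define y where "y k = real k / real N" for k
  have bm: "bump (Suc m) x = sqrt 2 - 1" unfolding x_def by (rule bump_at_half_power)
  hence nz: "bump (Suc m) x \<noteq> 0" by simp
  have f: "bump_sum p x z = 2 powr (- real (Suc m) / p) * (sqrt 2 - 1) * dist_int (2 ^ Suc m * z)" for z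
  proof -
    have "bump (Suc n) x = 0" if "n \<noteq> m" for n
      using bump_disjoint[OF nz, of "Suc n"] that by auto
    hence "bump_sum p x z = (\<Sum>n\<in>{m}. 2 powr (- real (Suc n) / p) * bump (Suc n) x * dist_int (2 ^ Suc n * z))"
      unfolding bump_sum_def by (intro suminf_finite) auto
    thus ?thesis by (simp add: bm)
  qed
  have "0 < N" by (simp add: N_def)
  hence py: "period_partition N y"
    by (auto simp: period_partition_def y_def strict_mono_on_def divide_strict_right_mono)
  have half: "2 ^ Suc m * y k = real k / 2" for k
    by (simp add: y_def N_def)
  have jump: "\<bar>dist_int (real (Suc k) / 2) - dist_int (real k / 2)\<bar> = 1 / 2" for k
  proof (cases "even k")
    case True
    then obtain l where "k = 2 * l" by (auto elim: evenE)
    hence "real k / 2 = of_int (int l)" "real (Suc k) / 2 = of_int (int l) + 1 / 2" by simp_all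
    thus ?thesis by (simp only: dist_int_of_int dist_int_half)
  next
    case False
    then obtain l where "k = 2 * l + 1" by (auto elim: oddE)
    hence "real k / 2 = of_int (int l) + 1 / 2" "real (Suc k) / 2 = of_int (int l + 1)" by simp_all
    thus ?thesis by (simp only: dist_int_of_int dist_int_half)
  qed
  have c0: "0 \<le> c" by (simp add: c_def)
  have incr: "\<bar>bump_sum p x (y (Suc k)) - bump_sum p x (y k)\<bar> = c" for k
  proof -
    have "bump_sum p x (y (Suc k)) - bump_sum p x (y k) = 2 powr (- real (Suc m) / p) * (sqrt 2 - 1) *
      (dist_int (real (Suc k) / 2) - dist_int (real k / 2))"
      unfolding f half by (simp only: right_diff_distrib)
    hence "\<bar>bump_sum p x (y (Suc k)) - bump_sum p x (y k)\<bar> = 2 powr (- real (Suc m) / p) * (sqrt 2 - 1) *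
      \<bar>dist_int (real (Suc k) / 2) - dist_int (real k / 2)\<bar>"
      by (simp add: abs_mult)
    thus ?thesis by (simp only: jump c_def)
  qed
  have "(sqrt 2 - 1) / 2 \<le> 2 powr (1 / p) * ((sqrt 2 - 1) / 2)"
    using mult_right_mono[of 1 "2 powr (1 / p)" "(sqrt 2 - 1) / 2"]
      assms ge_one_powr_ge_zero[of 2 "1 / p"] by simp
  also have "\<dots> = (2 powr real (Suc (Suc m))) powr (1 / p) * c"
  proof -
    have "1 / p = real (Suc (Suc m)) * (1 / p) + - real (Suc m) / p"
      using assms by (simp add: field_simps)
    hence "2 powr (1 / p) = (2 powr real (Suc (Suc m))) powr (1 / p) * 2 powr (- real (Suc m) / p)"
      by (simp only: powr_powr powr_add[symmetric])
    thus ?thesis by (simp only: c_def mult.assoc)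
  qed
  also have "\<dots> = (real N * c powr p) powr (1 / p)"
    using c0 assms by (simp add: N_def powr_mult powr_powr powr_realpow[of 2 "Suc (Suc m)", simplified])
  also have "\<dots> = (\<Sum>k<N. \<bar>bump_sum p x (y (Suc k)) - bump_sum p x (y k)\<bar> powr p) powr (1 / p)"
    by (simp add: incr)
  finally have "ennreal ((sqrt 2 - 1) / 2) \<le> pvar p (bump_sum p x)"
    using pvar_ge[OF py, of "bump_sum p x" p] by (meson ennreal_leI order_trans)
  thus ?thesis
    using enn2real_mono[of "ennreal ((sqrt 2 - 1) / 2)" "pvar p (bump_sum p x)"]
      pvar_bump_sum_vertical[OF assms, of x]
    by (simp add: phi_var_def x_def)
qed

lemma phi_var_alternates:
  assumes "1 < p"
  shows "(sqrt 2 - 1) / 2 \<le> \<bar>phi_var p (bump_sum p) (2 powr - (real i / 2))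
    - phi_var p (bump_sum p) (2 powr - (real (Suc i) / 2))\<bar>"
proof (cases "even i")
  case True
  then obtain l where "i = 2 * l" by (auto elim: evenE)
  hence "real i / 2 = real l" "real (Suc i) / 2 = real l + 1 / 2" by simp_all
  thus ?thesis using phi_var_at_half_power[OF assms, of l] by (simp only: phi_var_at_power)
next
  case False
  then obtain l where "i = 2 * l + 1" by (auto elim: oddE)
  hence "real i / 2 = real l + 1 / 2" "real (Suc i) / 2 = real (Suc l)" by simp_all
  thus ?thesis using phi_var_at_half_power[OF assms, of l] by (simp only: phi_var_at_power)
qed

lemma pvar_phi_var_bump_sum:
  assumes "1 < p"
  shows "pvar p (phi_var p (bump_sum p)) = \<infinity>"
proof (rule ccontr)
  define h where "h = phi_var p (bump_sum p)"
  define c where "c = (sqrt 2 - 1) / (2::real)"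
  have c0: "0 < c" by (simp add: c_def)
  assume "pvar p (phi_var p (bump_sum p)) \<noteq> \<infinity>"
  then obtain r where r: "0 \<le> r" "pvar p h = ennreal r"
    unfolding h_def by (cases "pvar p (phi_var p (bump_sum p))") auto
  have bound: "real N * c powr p \<le> r powr p" for N
  proof -
    \<comment> \<open>The geometric progression with ratio \<open>sqrt 2\<close> that ends in \<open>1\<close>, preceded by \<open>0\<close> to
      complete the period.\<close>
    define x where "x j = (if j = 0 then 0 else 2 powr - (real (Suc N - j) / 2))" for j :: nat
    have px: "period_partition (Suc N) x"
      by (auto simp: period_partition_def x_def strict_mono_on_def)
    have "real N * c powr p = (\<Sum>k<N. c powr p)" by simp
    also have "\<dots> \<le> (\<Sum>k<N. \<bar>h (x (Suc (Suc k))) - h (x (Suc k))\<bar> powr p)"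
    proof (rule sum_mono)
      fix k assume "k \<in> {..<N}"
      hence "x (Suc k) = 2 powr - (real (Suc (N - Suc k)) / 2)"
        "x (Suc (Suc k)) = 2 powr - (real (N - Suc k) / 2)"
        by (simp_all add: x_def Suc_diff_Suc)
      hence "c \<le> \<bar>h (x (Suc (Suc k))) - h (x (Suc k))\<bar>"
        using phi_var_alternates[OF assms, of "N - Suc k"] by (simp only: h_def c_def)
      thus "c powr p \<le> \<bar>h (x (Suc (Suc k))) - h (x (Suc k))\<bar> powr p"
        using c0 assms by (intro powr_mono2) auto
    qed
    also have "\<dots> \<le> (\<Sum>k<Suc N. \<bar>h (x (Suc k)) - h (x k)\<bar> powr p)" (is "_ \<le> ?S")
      by (simp only: sum.lessThan_Suc_shift) simp
    also have "\<dots> \<le> r powr p"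
    proof -
      have S0: "0 \<le> ?S" by (rule sum_nonneg) simp
      have "ennreal (?S powr (1 / p)) \<le> ennreal r"
        using pvar_ge[OF px, of h p] r by simp
      hence "?S powr (1 / p) \<le> r" using r by simp
      hence "(?S powr (1 / p)) powr p \<le> r powr p"
        using assms by (intro powr_mono2) auto
      thus ?thesis using assms S0 by (simp add: powr_powr)
    qed
    finally show ?thesis .
  qed
  obtain N :: nat where "r powr p < real N * c powr p"
    using ex_less_of_nat_mult[of "c powr p" "r powr p"] c0 by auto
  with bound[of N] show False by simp
qed

theorem theorem5p4:
  fixes p :: real
  assumes "1 < p"
  shows "bump_sum p \<in> H2_space p \<and> bump_sum p \<notin> VV_space p"
  using bump_sum_in_H2_space[OF assms] pvar_phi_var_bump_sum[OF assms]
  by (auto simp: VV_space_def)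

end
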